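(* Consider the pure integer convex program $$\textbf{(PICP)}\qquad z_{IP}=\min\{f(\mathbf{x}):\ \mathbf{A}\mathbf{x}=\mathbf{b},\ \mathbf{E}\mathbf{x}\le\mathbf{f},\ \mathbf{x}\in\mathbb{Z}^n\},$$ where $f:\mathbb{R}^n\to\mathbb{R}$ is convex and differentiable, $\mathbf{A},\mathbf{E}$ are rational full-rank matrices and $\mathbf{b},\mathbf{f}$ are rational vectors; assume (PICP) is feasible and that optimal solutions of (PICP) and of its continuous relaxation exist whenever these problems are feasible and bounded. If the continuous relaxation of (PICP) is feasible and bounded (has finite optimal value), then there exists $0<\rho<\infty$ such that $z^{LD+}_\rho=z_{IP}$, where the augmenting function is $\psi=\|\cdot\|$.
   Context: $\mathbf{A}$ has $m$ rows and $\|\cdot\|$ is the Euclidean norm. Let $X=\{\mathbf{x}\in\mathbb{Z}^n:\mathbf{E}\mathbf{x}\le\mathbf{f}\}$ (here $\mathbf{f}$ is a vector, distinct from the function $f$). The continuous relaxation replaces $\mathbb{Z}^n$ by $\mathbb{R}^n$. The augmented Lagrangian dual with augmenting function $\|\cdot\|$ and penalty parameter $\rho>0$ is $$z^{LD+}_\rho=\sup_{\boldsymbol\lambda\in\mathbb{R}^m}\ \min_{\mathbf{x}\in X}\ f(\mathbf{x})+\boldsymbol\lambda^\top(\mathbf{b}-\mathbf{A}\mathbf{x})+\rho\|\mathbf{b}-\mathbf{A}\mathbf{x}\|,$$ with the inner minimum read as an infimum if not attained. *)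

theory Defs
  imports "HOL-Analysis.Analysis"
begin

definition int_vecs :: "(real ^ 'n) set" where
  "int_vecs = {x. \<forall>j. x $ j \<in> \<int>}"

definition rational_vec :: "real ^ 'n \<Rightarrow> bool" where
  "rational_vec v \<longleftrightarrow> (\<forall>i. v $ i \<in> \<rat>)"

definition rational_matrix :: "real ^ 'n ^ 'm \<Rightarrow> bool" where
  "rational_matrix M \<longleftrightarrow> (\<forall>i j. M $ i $ j \<in> \<rat>)"

text \<open>Neither row nor column rank is singled out: an inequality system may well have
  more rows than columns (for example, box constraints).\<close>
definition full_rank :: "real ^ 'n ^ 'm \<Rightarrow> bool" where
  "full_rank M \<longleftrightarrow> rank M = min CARD('m) CARD('n)"

text \<open>The right-hand side of the inequality system is called \<open>d\<close>, as \<open>f\<close> is the objective.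
  The order on vectors is componentwise.\<close>
definition X_set :: "real ^ 'n ^ 'p \<Rightarrow> real ^ 'p \<Rightarrow> (real ^ 'n) set" where
  "X_set E d = {x \<in> int_vecs. E *v x \<le> d}"

definition picp_feasible ::
  "real ^ 'n ^ 'm \<Rightarrow> real ^ 'm \<Rightarrow> real ^ 'n ^ 'p \<Rightarrow> real ^ 'p \<Rightarrow> (real ^ 'n) set" where
  "picp_feasible A b E d = {x \<in> int_vecs. A *v x = b \<and> E *v x \<le> d}"

definition relax_feasible ::
  "real ^ 'n ^ 'm \<Rightarrow> real ^ 'm \<Rightarrow> real ^ 'n ^ 'p \<Rightarrow> real ^ 'p \<Rightarrow> (real ^ 'n) set" where
  "relax_feasible A b E d = {x. A *v x = b \<and> E *v x \<le> d}"

text \<open>Optimal values are extended reals, so that unbounded problems have value \<open>-\<infinity>\<close>;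
  this matters for the inner problems of the dual, which may be unbounded
  for some multipliers.\<close>
definition z_IP ::
  "(real ^ 'n \<Rightarrow> real) \<Rightarrow> real ^ 'n ^ 'm \<Rightarrow> real ^ 'm \<Rightarrow> real ^ 'n ^ 'p \<Rightarrow> real ^ 'p \<Rightarrow> ereal" where
  "z_IP f A b E d = (INF x \<in> picp_feasible A b E d. ereal (f x))"

definition z_LD_plus ::
  "(real ^ 'n \<Rightarrow> real) \<Rightarrow> real ^ 'n ^ 'm \<Rightarrow> real ^ 'm \<Rightarrow> real ^ 'n ^ 'p \<Rightarrow> real ^ 'p \<Rightarrow> real \<Rightarrow> ereal" where
  "z_LD_plus f A b E d \<rho> =
     (SUP l :: real ^ 'm. INF x \<in> X_set E d.
        ereal (f x + l \<bullet> (b - A *v x) + \<rho> * norm (b - A *v x)))"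

text \<open>For a minimisation problem ``bounded'' means bounded below on the feasible set.\<close>
definition feasible_and_bounded :: "('a \<Rightarrow> real) \<Rightarrow> 'a set \<Rightarrow> bool" where
  "feasible_and_bounded f S \<longleftrightarrow> S \<noteq> {} \<and> bdd_below (f ` S)"

definition has_optimal_solution :: "('a \<Rightarrow> real) \<Rightarrow> 'a set \<Rightarrow> bool" where
  "has_optimal_solution f S \<longleftrightarrow> (\<exists>x. is_arg_min f (\<lambda>y. y \<in> S) x)"

end

theory Submission
  imports Defs
begin

text \<open>Let \<open>x0\<close> minimise \<open>f\<close> over the continuous relaxation. By Farkas' lemma (finitely generated
  cones are closed) the first-order optimality conditions at \<open>x0\<close> supply a multiplier \<open>l\<close> with
  \<open>f x + l \<bullet> (b - A x) \<ge> f x0\<close> whenever \<open>E x \<le> d\<close>. Rationality of the data gives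
  \<open>\<delta> > 0\<close> with \<open>norm (b - A x) \<ge> \<delta>\<close> for every integral \<open>x\<close> with \<open>A x \<noteq> b\<close>. Hence a
  penalty \<open>\<rho>\<close> with \<open>\<rho> \<delta> \<ge> z_IP - f x0\<close> closes the gap at this single multiplier, and the
  other inequality is weak duality.\<close>

section \<open>First-order conditions for differentiable functions\<close>

lemma convex_above_tangent_plane:
  fixes f :: "'a::real_normed_vector \<Rightarrow> real"
  assumes conv: "convex_on UNIV f" and der: "(f has_derivative f') (at x0)"
  shows "f x0 + f' (x - x0) \<le> f x"
proof -
  \<comment> \<open>Restricting \<open>f\<close> to the line through \<open>x0\<close> and
    \<open>x\<close> reduces the claim to the one-variable tangent inequality, applied at 0 and
    evaluated at 1.\<close>
  define \<phi> where "\<phi> = (\<lambda>t::real. f (x0 + t *\<^sub>R (x - x0)))"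
  have "convex_on UNIV \<phi>"
  proof (rule convex_onI)
    fix t p q :: real
    assume t: "0 < t" "t < 1"
    have "x0 + ((1 - t) *\<^sub>R p + t *\<^sub>R q) *\<^sub>R (x - x0) =
        (1 - t) *\<^sub>R (x0 + p *\<^sub>R (x - x0)) + t *\<^sub>R (x0 + q *\<^sub>R (x - x0))"
      by (simp add: algebra_simps)
    then show "\<phi> ((1 - t) *\<^sub>R p + t *\<^sub>R q) \<le> (1 - t) * \<phi> p + t * \<phi> q"
      using convex_onD[OF conv, of t "x0 + p *\<^sub>R (x - x0)" "x0 + q *\<^sub>R (x - x0)"] t
      by (simp add: \<phi>_def)
  qed simp
  moreover have "(\<phi> has_field_derivative f' (x - x0)) (at 0)"
  proof -
    have "((\<lambda>t::real. x0 + t *\<^sub>R (x - x0)) has_derivative (\<lambda>t. t *\<^sub>R (x - x0))) (at 0)"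
      by (auto intro!: derivative_eq_intros)
    then have "(\<phi> has_derivative (\<lambda>t. f' (t *\<^sub>R (x - x0)))) (at 0)"
      unfolding \<phi>_def using der by (intro has_derivative_compose[of _ _ 0 UNIV f f']) auto
    moreover have "f' (t *\<^sub>R (x - x0)) = f' (x - x0) * t" for t
      using linear_scale[OF has_derivative_linear[OF der]] by simp
    ultimately show ?thesis
      by (simp add: has_field_derivative_def)
  qed
  ultimately have "\<phi> 1 - \<phi> 0 \<ge> f' (x - x0) * (1 - 0)"
    by (intro convex_on_imp_above_tangent[where A = UNIV]) auto
  then show ?thesis by (simp add: \<phi>_def)
qed

text \<open>Difference quotients at small positive \<open>t\<close> are nonnegative, and so is their
  limit. Only the right-hand side of 0 is considered because a feasible direction at a boundary
  point need not be feasible when reversed.\<close>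

lemma directional_derivative_nonneg:
  fixes f :: "'a::real_normed_vector \<Rightarrow> real"
  assumes der: "(f has_derivative f') (at x0)"
    and min: "eventually (\<lambda>t. f x0 \<le> f (x0 + t *\<^sub>R v)) (at_right 0)"
  shows "0 \<le> f' v"
proof -
  have "((\<lambda>t::real. x0 + t *\<^sub>R v) has_derivative (\<lambda>t. t *\<^sub>R v)) (at 0)"
    by (auto intro!: derivative_eq_intros)
  then have "((\<lambda>t::real. f (x0 + t *\<^sub>R v)) has_derivative (\<lambda>t. f' (t *\<^sub>R v))) (at 0)"
    using der by (intro has_derivative_compose[of _ _ 0 UNIV f f']) auto
  moreover have "f' (t *\<^sub>R v) = f' v * t" for t
    using linear_scale[OF has_derivative_linear[OF der]] by simp
  ultimately have "((\<lambda>t::real. f (x0 + t *\<^sub>R v)) has_field_derivative f' v) (at 0)"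
    by (simp add: has_field_derivative_def)
  then have "((\<lambda>t. (f (x0 + t *\<^sub>R v) - f x0) / t) \<longlongrightarrow> f' v) (at 0)"
    by (simp add: has_field_derivative_iff)
  then have "((\<lambda>t. (f (x0 + t *\<^sub>R v) - f x0) / t) \<longlongrightarrow> f' v) (at_right 0)"
    by (rule tendsto_within_subset) simp
  moreover have "eventually (\<lambda>t. 0 \<le> (f (x0 + t *\<^sub>R v) - f x0) / t) (at_right 0)"
    using min eventually_at_right_less[of "0::real"] by eventually_elim simp
  ultimately show ?thesis
    by (rule tendsto_lowerbound) simp
qed

section \<open>Polyhedra, Farkas' lemma and Lagrange multipliers\<close>

lemma eventually_feasible_direction:
  fixes E :: "real ^ 'n ^ 'p"
  assumes x0: "E *v x0 \<le> d"
    and act: "\<And>i. (E *v x0) $ i = d $ i \<Longrightarrow> (E *v v) $ i \<le> 0"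
  shows "eventually (\<lambda>t. E *v (x0 + t *\<^sub>R v) \<le> d) (at_right 0)"
proof -
  have "eventually (\<lambda>t. (E *v x0) $ i + t * (E *v v) $ i \<le> d $ i) (at_right 0)" for i
  proof (cases "(E *v x0) $ i = d $ i")
    case True
    show ?thesis
      using eventually_at_right_less[of "0::real"]
      by eventually_elim (use act[OF True] True in \<open>simp add: mult_le_0_iff\<close>)
  next
    case False
    then have "(E *v x0) $ i < d $ i"
      using x0 by (auto simp: less_eq_vec_def order.strict_iff_order)
    \<comment> \<open>An inactive row has slack at \<open>x0\<close>, which survives for small
      \<open>t\<close> by continuity.\<close>
    moreover have "((\<lambda>t. (E *v x0) $ i + t * (E *v v) $ i) \<longlongrightarrow> (E *v x0) $ i + 0 * (E *v v) $ i)
        (at_right 0)"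
      by (intro tendsto_intros)
    ultimately have "eventually (\<lambda>t. (E *v x0) $ i + t * (E *v v) $ i < d $ i) (at_right 0)"
      by (intro order_tendstoD(2)) auto
    then show ?thesis by eventually_elim simp
  qed
  then have "eventually (\<lambda>t. \<forall>i. (E *v x0) $ i + t * (E *v v) $ i \<le> d $ i) (at_right 0)"
    by (rule eventually_all_finite)
  then show ?thesis
    by eventually_elim
      (simp add: less_eq_vec_def matrix_vector_right_distrib matrix_vector_mult_scaleR)
qed

text \<open>A finitely generated cone is closed, so a hyperplane with normal \<open>a\<close>
  strictly separates \<open>w\<close> from it. Since the cone contains 0, the offset
  \<open>c\<close> is negative; closure under scaling then makes \<open>a\<close> nonnegative on
  \<open>S\<close>, and \<open>v = -a\<close> works.\<close>

lemma farkas_convex_cone_hull: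
  fixes w :: "'a::euclidean_space"
  assumes "finite S" and "w \<notin> convex_cone hull S"
  obtains v where "\<And>s. s \<in> S \<Longrightarrow> s \<bullet> v \<le> 0" and "0 < w \<bullet> v"
proof -
  let ?K = "convex_cone hull S"
  obtain a c where a: "a \<bullet> w < c" "\<And>x. x \<in> ?K \<Longrightarrow> c < a \<bullet> x"
    using separating_hyperplane_closed_point[OF convex_convex_cone_hull closed_convex_cone_hull] assms
    by metis
  have "c < 0"
    using a(2)[OF convex_cone_hull_contains_0] by simp
  have "0 \<le> a \<bullet> s" if "s \<in> S" for s
  proof (rule ccontr)
    assume neg: "\<not> 0 \<le> a \<bullet> s"
    \<comment> \<open>This positive multiple of \<open>s\<close> has inner product exactly
      \<open>c\<close> with \<open>a\<close>, contradicting strict separation.\<close>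
    have "(c / (a \<bullet> s)) *\<^sub>R s \<in> ?K"
      using that neg \<open>c < 0\<close> by (intro convex_cone_hull_mul hull_inc) (auto simp: divide_nonpos_neg)
    from a(2)[OF this] show False using neg by simp
  qed
  with a(1) \<open>c < 0\<close> show ?thesis
    by (intro that[of "- a"]) (auto simp: inner_commute)
qed

text \<open>By Farkas, \<open>-g\<close> is a conic combination of the rows of \<open>A\<close> with
  both signs and the active rows of \<open>E\<close>. The coefficients of the former make up
  \<open>l\<close>; the latter only help, since an active row satisfies
  \<open>(E *v x) $ i \<le> d $ i = (E *v x0) $ i\<close>.\<close>

lemma lagrange_multiplier_polyhedron:
  fixes A :: "real ^ 'n ^ 'm" and E :: "real ^ 'n ^ 'p"
  assumes Ax0: "A *v x0 = b"
    and nodescent: "\<And>v. \<lbrakk>A *v v = 0; \<And>i. (E *v x0) $ i = d $ i \<Longrightarrow> (E *v v) $ i \<le> 0\<rbrakk>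
      \<Longrightarrow> 0 \<le> g \<bullet> v"
  obtains l where "\<And>x. E *v x \<le> d \<Longrightarrow> 0 \<le> g \<bullet> (x - x0) + l \<bullet> (b - A *v x)"
proof -
  define I where "I = {i. (E *v x0) $ i = d $ i}"
  define S where "S = range (\<lambda>i. A $ i) \<union> range (\<lambda>i. - A $ i) \<union> (\<lambda>i. E $ i) ` I"
  have fin: "finite S" by (simp add: S_def)
  have "- g \<in> convex_cone hull S"
  proof (rule ccontr)
    assume "- g \<notin> convex_cone hull S"
    then obtain v where v: "\<And>s. s \<in> S \<Longrightarrow> s \<bullet> v \<le> 0" "0 < - g \<bullet> v"
      using farkas_convex_cone_hull[OF fin] by blast
    have "A $ i \<bullet> v = 0" for i
      using v(1)[of "A $ i"] v(1)[of "- A $ i"] by (auto simp: S_def)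
    then have "A *v v = 0"
      by (simp add: vec_eq_iff matrix_vector_mul_component)
    moreover have "(E *v v) $ i \<le> 0" if "(E *v x0) $ i = d $ i" for i
      using v(1)[of "E $ i"] that by (auto simp: S_def I_def matrix_vector_mul_component)
    ultimately have "0 \<le> g \<bullet> v" by (rule nodescent)
    then show False using v(2) by simp
  qed
  \<comment> \<open>Rather than extracting coefficients, \<open>C\<close> collects all vectors for
    which a multiplier exists. It is a convex cone containing the generators, hence contains their
    hull.\<close>
  moreover define C where
    "C = {w. \<exists>l. \<forall>x. E *v x \<le> d \<longrightarrow> w \<bullet> (x - x0) \<le> l \<bullet> (b - A *v x)}"
  have "convex_cone hull S \<subseteq> C"
  proof (rule hull_minimal)
    have "A $ i \<in> C" "- A $ i \<in> C" for i
    proof -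
      have eq: "A $ i \<bullet> (x - x0) = - (axis i 1 \<bullet> (b - A *v x))" for x
        using Ax0 by (auto simp: inner_axis' inner_diff_right matrix_vector_mul_component)
      show "A $ i \<in> C"
        unfolding C_def using eq by (auto intro!: exI[of _ "- axis i 1"])
      show "- A $ i \<in> C"
        unfolding C_def using eq by (auto intro!: exI[of _ "axis i 1"])
    qed
    moreover have "E $ i \<in> C" if "i \<in> I" for i
      unfolding C_def using that
      by (auto intro!: exI[of _ 0]
          simp: I_def inner_diff_right less_eq_vec_def matrix_vector_mul_component)
    ultimately show "S \<subseteq> C" by (auto simp: S_def)
    show "convex_cone C"
      unfolding convex_cone_iff
    proof (intro conjI ballI allI impI)
      show "0 \<in> C" by (auto simp: C_def intro!: exI[of _ 0])
    next
      fix p q assume "p \<in> C" "q \<in> C"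
      then obtain k l where "\<forall>x. E *v x \<le> d \<longrightarrow> p \<bullet> (x - x0) \<le> k \<bullet> (b - A *v x)"
        "\<forall>x. E *v x \<le> d \<longrightarrow> q \<bullet> (x - x0) \<le> l \<bullet> (b - A *v x)"
        by (auto simp: C_def)
      then show "p + q \<in> C"
        unfolding C_def by (auto simp: inner_add_left intro!: exI[of _ "k + l"] add_mono)
    next
      fix p and c :: real assume "p \<in> C" "0 \<le> c"
      then obtain k where "\<forall>x. E *v x \<le> d \<longrightarrow> p \<bullet> (x - x0) \<le> k \<bullet> (b - A *v x)"
        by (auto simp: C_def)
      then show "c *\<^sub>R p \<in> C"
        unfolding C_def using \<open>0 \<le> c\<close> by (auto intro!: exI[of _ "c *\<^sub>R k"] mult_left_mono)
    qed
  qed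
  ultimately obtain l where "\<forall>x. E *v x \<le> d \<longrightarrow> (- g) \<bullet> (x - x0) \<le> l \<bullet> (b - A *v x)"
    by (auto simp: C_def)
  then have "0 \<le> g \<bullet> (x - x0) + l \<bullet> (b - A *v x)" if "E *v x \<le> d" for x
    using that by (force simp: inner_minus_left)
  then show ?thesis by (rule that)
qed

text \<open>Minimality of \<open>x0\<close> rules out feasible descent directions, which yields a
  multiplier for the linearization of \<open>f\<close> at \<open>x0\<close>. By convexity
  \<open>f\<close> lies above this linearization, so the same multiplier serves
  \<open>f\<close>.\<close>

lemma convex_lagrange_multiplier:
  fixes A :: "real ^ 'n ^ 'm" and E :: "real ^ 'n ^ 'p" and f :: "real ^ 'n \<Rightarrow> real"
  assumes conv: "convex_on UNIV f" and diff: "f differentiable at x0"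
    and feas: "A *v x0 = b" "E *v x0 \<le> d"
    and min: "\<And>x. \<lbrakk>A *v x = b; E *v x \<le> d\<rbrakk> \<Longrightarrow> f x0 \<le> f x"
  obtains l where "\<And>x. E *v x \<le> d \<Longrightarrow> f x0 \<le> f x + l \<bullet> (b - A *v x)"
proof -
  obtain f' where der: "(f has_derivative f') (at x0)"
    using diff by (auto simp: differentiable_def)
  \<comment> \<open>The gradient of \<open>f\<close> at \<open>x0\<close>, representing the
    functional \<open>f'\<close> as an inner product.\<close>
  define g where "g = adjoint f' 1"
  have g: "f' v = g \<bullet> v" for v
    using adjoint_works[OF has_derivative_linear[OF der], of v 1]
    by (simp add: g_def inner_commute)
  have "0 \<le> g \<bullet> v"
    if v: "A *v v = 0" "\<And>i. (E *v x0) $ i = d $ i \<Longrightarrow> (E *v v) $ i \<le> 0" for v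
  proof -
    have "eventually (\<lambda>t. E *v (x0 + t *\<^sub>R v) \<le> d) (at_right 0)"
      using feas(2) v(2) by (rule eventually_feasible_direction)
    then have "eventually (\<lambda>t. f x0 \<le> f (x0 + t *\<^sub>R v)) (at_right 0)"
      by eventually_elim
        (simp add: min matrix_vector_right_distrib matrix_vector_mult_scaleR feas(1) v(1))
    from directional_derivative_nonneg[OF der this] show ?thesis by (simp add: g)
  qed
  then obtain l where l: "\<And>x. E *v x \<le> d \<Longrightarrow> 0 \<le> g \<bullet> (x - x0) + l \<bullet> (b - A *v x)"
    using lagrange_multiplier_polyhedron[OF feas(1), of E d g] by blast
  have "f x0 \<le> f x + l \<bullet> (b - A *v x)" if "E *v x \<le> d" for x
    using l[OF that] convex_above_tangent_plane[OF conv der, of x] by (simp add: g)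
  then show ?thesis by (rule that)
qed

section \<open>Integrality gap of the residual\<close>

lemma finite_rationals_common_denominator:
  fixes S :: "real set"
  assumes "finite S" and "S \<subseteq> \<rat>"
  obtains N :: nat where "0 < N" and "\<And>r. r \<in> S \<Longrightarrow> real N * r \<in> \<int>"
  using assms
proof (induction S arbitrary: thesis rule: finite_induct)
  case empty
  from empty.prems(1)[of 1] show ?case by simp
next
  case (insert q S)
  obtain N :: nat where N: "0 < N" "\<And>r. r \<in> S \<Longrightarrow> real N * r \<in> \<int>"
    using insert.IH insert.prems(2) by blast
  obtain i :: int and n :: nat where q: "q = real_of_int i / real n" "n \<noteq> 0"
    using insert.prems(2) by (auto simp: Rats_eq_int_div_nat)
  show ?case
  proof (rule insert.prems(1)[of "N * n"])
    show "0 < N * n" using N(1) q(2) by simp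
    fix r assume "r \<in> insert q S"
    then show "real (N * n) * r \<in> \<int>"
    proof
      assume "r = q"
      then have "real (N * n) * r = of_int (int N * i)" using q by simp
      then show ?thesis by (metis Ints_of_int)
    next
      assume "r \<in> S"
      then have "real n * (real N * r) \<in> \<int>" by (intro Ints_mult[OF Ints_of_nat] N(2))
      then show ?thesis by (simp only: of_nat_mult mult_ac)
    qed
  qed
qed

text \<open>If \<open>N\<close> is a common denominator of all entries of \<open>A\<close> and
  \<open>b\<close>, then \<open>N\<close> times the residual of an integral point is an integer
  vector, so a nonzero component has absolute value at least \<open>1 / N\<close>.\<close>

lemma rational_residual_bounded_away:
  fixes A :: "real ^ 'n ^ 'm"
  assumes "rational_matrix A" and "rational_vec b"
  obtains \<delta> where "0 < \<delta>"
    and "\<And>x. \<lbrakk>x \<in> int_vecs; A *v x \<noteq> b\<rbrakk> \<Longrightarrow> \<delta> \<le> norm (b - A *v x)"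
proof -
  define S where "S = range (\<lambda>(i, j). A $ i $ j) \<union> range (\<lambda>i. b $ i)"
  have "finite S" "S \<subseteq> \<rat>"
    using assms by (auto simp: S_def rational_matrix_def rational_vec_def)
  then obtain N :: nat where N: "0 < N" "\<And>r. r \<in> S \<Longrightarrow> real N * r \<in> \<int>"
    using finite_rationals_common_denominator by blast
  have NA: "real N * A $ i $ j \<in> \<int>" for i j
    by (rule N(2)) (force simp: S_def)
  have Nb: "real N * b $ i \<in> \<int>" for i
    by (rule N(2)) (simp add: S_def)
  have "1 / real N \<le> norm (b - A *v x)" if x: "x \<in> int_vecs" "A *v x \<noteq> b" for x
  proof -
    obtain i where i: "(b - A *v x) $ i \<noteq> 0"
      using x(2) by (force simp: vec_eq_iff)
    have "real N * (b - A *v x) $ i = real N * b $ i - (\<Sum>j\<in>UNIV. (real N * A $ i $ j) * x $ j)"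
      by (simp add: matrix_vector_mult_def right_diff_distrib sum_distrib_left mult.assoc)
    also have "\<dots> \<in> \<int>"
      using x(1) by (intro Ints_diff Nb Ints_sum Ints_mult[OF NA]) (simp add: int_vecs_def)
    finally have "1 \<le> \<bar>real N * (b - A *v x) $ i\<bar>"
      using i N(1) by (intro Ints_nonzero_abs_ge1) auto
    then have "1 / real N \<le> \<bar>(b - A *v x) $ i\<bar>"
      using N(1) by (simp only: abs_mult) (simp add: divide_le_eq mult.commute)
    also have "\<dots> \<le> norm (b - A *v x)" by (rule component_le_norm_cart)
    finally show ?thesis .
  qed
  with N(1) show ?thesis by (intro that[of "1 / real N"]) auto
qed

section \<open>Weak duality and the choice of the penalty\<close>

lemma z_LD_plus_le_z_IP: "z_LD_plus f A b E d \<rho> \<le> z_IP f A b E d"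
  unfolding z_LD_plus_def z_IP_def
proof (intro SUP_least INF_greatest)
  fix l and x assume "x \<in> picp_feasible A b E d"
  \<comment> \<open>At a feasible \<open>x\<close> the residual vanishes, so the dual objective
    there equals \<open>f x\<close>, whatever \<open>l\<close> and \<open>\<rho>\<close>
    are.\<close>
  then show "(INF x\<in>X_set E d. ereal (f x + l \<bullet> (b - A *v x) + \<rho> * norm (b - A *v x))) \<le> ereal (f x)"
    by (intro INF_lower2[of x]) (auto simp: picp_feasible_def X_set_def)
qed

theorem proposition4p20:
  fixes f :: "real ^ 'n \<Rightarrow> real"
    and A :: "real ^ 'n ^ 'm" and b :: "real ^ 'm"
    and E :: "real ^ 'n ^ 'p" and d :: "real ^ 'p"
  assumes "convex_on UNIV f"
    and "f differentiable_on UNIV"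
    and "rational_matrix A" and "full_rank A"
    and "rational_matrix E" and "full_rank E"
    and "rational_vec b" and "rational_vec d"
    and "picp_feasible A b E d \<noteq> {}"
    and "feasible_and_bounded f (picp_feasible A b E d) \<Longrightarrow>
           has_optimal_solution f (picp_feasible A b E d)"
    and "feasible_and_bounded f (relax_feasible A b E d) \<Longrightarrow>
           has_optimal_solution f (relax_feasible A b E d)"
    and "feasible_and_bounded f (relax_feasible A b E d)"
  shows "\<exists>\<rho>::real. 0 < \<rho> \<and> z_LD_plus f A b E d \<rho> = z_IP f A b E d"
proof -
  obtain x0 where "is_arg_min f (\<lambda>y. y \<in> relax_feasible A b E d) x0"
    using assms(11,12) by (auto simp: has_optimal_solution_def)
  then have x0: "A *v x0 = b" "E *v x0 \<le> d"
      "\<And>x. \<lbrakk>A *v x = b; E *v x \<le> d\<rbrakk> \<Longrightarrow> f x0 \<le> f x"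
    by (auto simp: is_arg_min_linorder relax_feasible_def)
  have "f differentiable at x0"
    using assms(2) by (simp add: differentiable_on_def)
  then obtain l where l: "\<And>x. E *v x \<le> d \<Longrightarrow> f x0 \<le> f x + l \<bullet> (b - A *v x)"
    using convex_lagrange_multiplier[OF assms(1) _ x0] by blast
  obtain \<delta> where \<delta>: "0 < \<delta>"
      "\<And>x. \<lbrakk>x \<in> int_vecs; A *v x \<noteq> b\<rbrakk> \<Longrightarrow> \<delta> \<le> norm (b - A *v x)"
    using rational_residual_bounded_away[OF assms(3,7)] by blast
  obtain y where y: "y \<in> picp_feasible A b E d" using assms(9) by blast
  then have "f x0 \<le> f y" by (auto simp: picp_feasible_def x0(3))
  \<comment> \<open>Chosen so that \<open>\<rho> * \<delta>\<close> exceeds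
    \<open>f y - f x0\<close>, where \<open>f y\<close> bounds \<open>z_IP\<close> from above; the
    added 1 keeps \<open>\<rho>\<close> positive even when \<open>f y = f x0\<close>.\<close>
  define \<rho> where "\<rho> = (f y - f x0 + 1) / \<delta>"
  have "0 < \<rho>" using \<open>f x0 \<le> f y\<close> \<delta>(1) by (simp add: \<rho>_def)
  have "z_IP f A b E d \<le> ereal (f x + l \<bullet> (b - A *v x) + \<rho> * norm (b - A *v x))"
    if x: "x \<in> X_set E d" for x
  proof (cases "A *v x = b")
    case True
    then have "x \<in> picp_feasible A b E d"
      using x by (simp add: X_set_def picp_feasible_def)
    then show ?thesis
      using True by (auto simp: z_IP_def intro: INF_lower)
  next
    case False
    \<comment> \<open>The Lagrangian term alone guarantees only \<open>f x0\<close>; the penalty on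
      a nonzero residual, at least \<open>\<rho> * \<delta>\<close>, lifts this bound past
      \<open>f y\<close>.\<close>
    have "z_IP f A b E d \<le> ereal (f y)"
      using y by (auto simp: z_IP_def intro: INF_lower)
    also have "f y \<le> f x0 + \<rho> * \<delta>"
      using \<delta>(1) by (simp add: \<rho>_def)
    also have "\<rho> * \<delta> \<le> \<rho> * norm (b - A *v x)"
      using \<open>0 < \<rho>\<close> \<delta>(2)[of x] x False by (simp add: X_set_def)
    also have "f x0 \<le> f x + l \<bullet> (b - A *v x)"
      using l x by (simp add: X_set_def)
    finally show ?thesis by simp
  qed
  then have "z_IP f A b E d \<le> z_LD_plus f A b E d \<rho>"
    unfolding z_LD_plus_def by (intro SUP_upper2[of l] INF_greatest) auto
  then have "z_LD_plus f A b E d \<rho> = z_IP f A b E d"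
    using z_LD_plus_le_z_IP by (intro antisym)
  with \<open>0 < \<rho>\<close> show ?thesis by blast
qed

end
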